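(* Let $X$ be a $1$-dimensional hereditarily unicoherent continuum and let $v\in X$. Suppose that there is a family $\mathcal L$ of arcs in $X$ such that $|\mathcal L|\geq 3$ and (1) $X=\bigcup_{L\in\mathcal L}L$; (2) for all $L_1,L_2\in\mathcal L$, if $L_1\neq L_2$ then $L_1\cap L_2=\{v\}$. Then $X$ is a fan.
   Context: A continuum is a non-empty compact connected metric space; a subcontinuum is a subspace of a continuum which is itself a continuum. A continuum is $1$-dimensional if its (small inductive) topological dimension equals $1$. A continuum $Y$ is unicoherent if for any subcontinua $A,B$ of $Y$ with $Y=A\cup B$, the set $A\cap B$ is connected; it is hereditarily unicoherent if each of its subcontinua is unicoherent. An arc is a space homeomorphic to $[0,1]$. A dendroid is an arcwise connected, hereditarily unicoherent continuum. A simple triod is a space homeomorphic to $([-1,1]\times\{0\})\cup(\{0\}\times[0,1])$; its top is the point corresponding to $(0,0)$ under such a homeomorphism. A point $x$ of a dendroid $Y$ is a ramification point of $Y$ if there is a simple triod in $Y$ with top $x$. A fan is a dendroid with at most one ramification point. *)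

theory Defs
  imports "HOL-Analysis.Analysis"
begin

definition continuum :: "'a::metric_space set \<Rightarrow> bool" where
  "continuum X \<longleftrightarrow> X \<noteq> {} \<and> compact X \<and> connected X"

definition subcontinuum :: "'a::metric_space set \<Rightarrow> 'a set \<Rightarrow> bool" where
  "subcontinuum A Y \<longleftrightarrow> A \<subseteq> Y \<and> continuum A"

definition one_dimensional :: "'a::metric_space set \<Rightarrow> bool" where
  "one_dimensional X \<longleftrightarrow> (top_of_set X) dim_le 1 \<and> \<not> (top_of_set X) dim_le 0"

definition unicoherent :: "'a::metric_space set \<Rightarrow> bool" where
  "unicoherent Y \<longleftrightarrow>
     (\<forall>A B. subcontinuum A Y \<and> subcontinuum B Y \<and> Y = A \<union> B \<longrightarrow> connected (A \<inter> B))"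

definition hereditarily_unicoherent :: "'a::metric_space set \<Rightarrow> bool" where
  "hereditarily_unicoherent Y \<longleftrightarrow> (\<forall>Z. subcontinuum Z Y \<longrightarrow> unicoherent Z)"

text \<open>An arc as a space; the library's \<^const>\<open>arc\<close> is a predicate on parametrisations.\<close>

definition is_arc :: "'a::metric_space set \<Rightarrow> bool" where
  "is_arc A \<longleftrightarrow> A homeomorphic {0..1::real}"

definition arcwise_connected :: "'a::metric_space set \<Rightarrow> bool" where
  "arcwise_connected Y \<longleftrightarrow>
     (\<forall>x\<in>Y. \<forall>y\<in>Y. x \<noteq> y \<longrightarrow>
        (\<exists>g. arc g \<and> path_image g \<subseteq> Y \<and> pathstart g = x \<and> pathfinish g = y))"

definition dendroid :: "'a::metric_space set \<Rightarrow> bool" where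
  "dendroid Y \<longleftrightarrow> continuum Y \<and> arcwise_connected Y \<and> hereditarily_unicoherent Y"

definition standard_triod :: "(real \<times> real) set" where
  "standard_triod = ({-1..1} \<times> {0}) \<union> ({0} \<times> {0..1})"

definition simple_triod_with_top :: "'a::metric_space set \<Rightarrow> 'a \<Rightarrow> bool" where
  "simple_triod_with_top T x \<longleftrightarrow>
     (\<exists>h k. homeomorphism standard_triod T h k \<and> h (0, 0) = x)"

definition ramification_point :: "'a::metric_space set \<Rightarrow> 'a \<Rightarrow> bool" where
  "ramification_point Y x \<longleftrightarrow> (\<exists>T \<subseteq> Y. simple_triod_with_top T x)"

definition fan :: "'a::metric_space set \<Rightarrow> bool" where
  "fan Y \<longleftrightarrow> dendroid Y \<and> (\<exists>\<^sub>\<le>\<^sub>1 x. ramification_point Y x)"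

end

theory Submission
  imports Defs
begin

text \<open>
  Unicoherence of \<open>C \<union> (L \<union> L')\<close> shows that a subcontinuum \<open>C\<close> of \<open>X\<close> meets \<open>L \<union> L'\<close> in a
  connected set. As \<open>v\<close> separates \<open>L - {v}\<close> from \<open>L' - {v}\<close>, a subcontinuum that misses \<open>v\<close>
  lies in a single arc of the family. A triod with top \<open>x \<noteq> v\<close> could be shrunk towards \<open>x\<close> until
  it misses \<open>v\<close> and would then embed into an arc, which is impossible. So \<open>v\<close> is the only
  possible ramification point.
\<close>

section \<open>Arcs as continua\<close>

lemma is_arc_imp_continuum:
  assumes "is_arc L"
  shows "continuum L"
  using assms homeomorphic_compactness[of L "{0..1::real}"] homeomorphic_connectedness[of L "{0..1::real}"]
    homeomorphic_empty(1)[of "{0..1::real}"]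
  by (auto simp: is_arc_def continuum_def)

text \<open>Links arcs as spaces to injective paths: a straight segment of \<open>{0..1}\<close>
  between the two parameters is carried into \<open>L\<close> by the homeomorphism.\<close>

lemma is_arc_subarc:
  fixes L :: "'a::metric_space set"
  assumes "is_arc L" "x \<in> L" "y \<in> L" "x \<noteq> y"
  obtains g where "arc g" "path_image g \<subseteq> L" "pathstart g = x" "pathfinish g = y"
proof -
  obtain f h where hom: "homeomorphism {0..1::real} L h f"
    using assms(1) homeomorphic_sym unfolding is_arc_def homeomorphic_def by blast
  have xy: "f x \<in> {0..1}" "f y \<in> {0..1}" "h (f x) = x" "h (f y) = y"
    using hom assms by (auto simp: homeomorphism_def)
  have ne: "f x \<noteq> f y"
    using xy assms by metis
  have sub: "path_image (linepath (f x) (f y)) \<subseteq> {0..1}"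
    using xy by (simp add: closed_segment_subset)
  have inj: "inj_on h {0..1}"
    using hom by (metis homeomorphism_def inj_on_inverseI)
  have "arc (h \<circ> linepath (f x) (f y))"
    unfolding arc_def
  proof
    show "path (h \<circ> linepath (f x) (f y))"
      using hom sub by (intro path_continuous_image) (auto simp: homeomorphism_def elim: continuous_on_subset)
    show "inj_on (h \<circ> linepath (f x) (f y)) {0..1}"
      using arc_linepath[OF ne] sub inj
      by (intro comp_inj_on) (auto simp: arc_def path_image_def elim: inj_on_subset)
  qed
  moreover have "path_image (h \<circ> linepath (f x) (f y)) \<subseteq> L"
    using hom sub by (auto simp: path_image_compose homeomorphism_def)
  ultimately show thesis
    using that xy by (simp add: pathstart_compose pathfinish_compose)
qed

section \<open>Hereditary unicoherence and subcontinua that miss the centre\<close>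

text \<open>Because \<open>A\<close> and \<open>B\<close> meet, their union is itself a
  subcontinuum, and its unicoherence applies to the decomposition into \<open>A\<close> and
  \<open>B\<close>.\<close>

lemma connected_Int_subcontinua:
  assumes "hereditarily_unicoherent X" "subcontinuum A X" "subcontinuum B X" "A \<inter> B \<noteq> {}"
  shows "connected (A \<inter> B)"
proof -
  have "subcontinuum (A \<union> B) X"
    using assms by (auto simp: subcontinuum_def continuum_def connected_Un)
  then have "unicoherent (A \<union> B)"
    using assms(1) hereditarily_unicoherent_def by blast
  moreover have "subcontinuum A (A \<union> B)" "subcontinuum B (A \<union> B)"
    using assms by (auto simp: subcontinuum_def)
  ultimately show ?thesis
    unfolding unicoherent_def by blast
qed

text \<open>One member \<open>M\<close> is fixed, and each point of \<open>C\<close> is tested with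
  just one further member \<open>N\<close> through it. Only unions of two members occur, so they
  stay compact even if the family is infinite.\<close>

lemma subcontinuum_avoiding_centre:
  fixes X :: "'a::metric_space set"
  assumes hu: "hereditarily_unicoherent X"
    and L: "\<And>L. L \<in> \<L> \<Longrightarrow> subcontinuum L X \<and> v \<in> L"
    and cover: "X = \<Union>\<L>"
    and Int: "\<And>L1 L2. L1 \<in> \<L> \<Longrightarrow> L2 \<in> \<L> \<Longrightarrow> L1 \<noteq> L2 \<Longrightarrow> L1 \<inter> L2 = {v}"
    and C: "subcontinuum C X" "v \<notin> C"
  obtains L where "L \<in> \<L>" "C \<subseteq> L"
proof -
  obtain x where "x \<in> C"
    using C by (auto simp: subcontinuum_def continuum_def)
  moreover have "C \<subseteq> X"
    using C by (simp add: subcontinuum_def)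
  ultimately obtain M where M: "M \<in> \<L>" "x \<in> M"
    using cover by blast
  have "C \<subseteq> M"
  proof
    fix t assume "t \<in> C"
    then obtain N where N: "N \<in> \<L>" "t \<in> N"
      using \<open>C \<subseteq> X\<close> cover by blast
    have "subcontinuum (M \<union> N) X"
      using L[OF M(1)] L[OF N(1)] connected_Un[of M N]
      by (auto simp: subcontinuum_def continuum_def)
    then have conn: "connected (C \<inter> (M \<union> N))"
      using \<open>x \<in> C\<close> M(2) by (intro connected_Int_subcontinua[OF hu C(1)]) auto
    have closed: "closed M" "closed N"
      using L M N by (auto simp: subcontinuum_def continuum_def compact_imp_closed)
    show "t \<in> M"
    proof (rule ccontr)
      assume "t \<notin> M"
      then have "M \<inter> N = {v}"
        using Int M N by blast
      \<comment> \<open>As \<open>v\<close> is not in \<open>C\<close>, the closed sets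
        \<open>M\<close> and \<open>N\<close> split this set into disjoint parts, one containing
        \<open>x\<close> and the other \<open>t\<close>, against \<open>conn\<close>.\<close>
      then have "M \<inter> N \<inter> (C \<inter> (M \<union> N)) = {}"
        using C(2) by auto
      with conn closed show False
        using \<open>t \<in> C\<close> \<open>x \<in> C\<close> M(2) N(2) unfolding connected_closed by blast
    qed
  qed
  with M(1) that show thesis by blast
qed

section \<open>Simple triods: no embedding into an arc, and shrinking towards the top\<close>

lemma continuum_standard_triod: "continuum standard_triod"
proof -
  have "(0, 0) \<in> ({-1..1} \<times> {0}) \<inter> ({0} \<times> {0..1} :: (real \<times> real) set)"
    by simp
  moreover have "connected ({-1..1} \<times> {0} :: (real \<times> real) set)"
    "connected ({0} \<times> {0..1} :: (real \<times> real) set)"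
    by (auto intro!: connected_Times)
  ultimately have "connected ({-1..1} \<times> {0} \<union> {0} \<times> {0..1} :: (real \<times> real) set)"
    by (metis connected_Un empty_iff)
  then show ?thesis
    unfolding continuum_def standard_triod_def by (auto intro!: compact_Un compact_Times)
qed

text \<open>Two of the three legs leave the top on the same side of its image, hence overlap.\<close>

lemma standard_triod_not_embeddable_real:
  fixes f :: "real \<times> real \<Rightarrow> real"
  assumes cont: "continuous_on standard_triod f" and inj: "inj_on f standard_triod"
  shows False
proof -
  \<comment> \<open>The legs are numbered 0, 1, 2 and run from the top at \<open>t = 0\<close> to
    their ends at \<open>t = 1\<close>. Every index above 1 gives the vertical leg, hence the bounds
    \<open>i < 3\<close> below.\<close>
  define leg :: "nat \<Rightarrow> real \<Rightarrow> real \<times> real"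
    where "leg i t = (if i = 0 then (t, 0) else if i = 1 then (- t, 0) else (0, t))" for i t
  have leg_in: "leg i t \<in> standard_triod" if "t \<in> {0..1}" for i t
    using that by (auto simp: leg_def standard_triod_def)
  have leg0: "leg i 0 = (0, 0)" for i
    by (simp add: leg_def zero_prod_def)
  have leg_eq: "i = j \<or> t = 0"
    if "leg i s = leg j t" "i < 3" "j < 3" "s \<in> {0..1}" "t \<in> {0..1}" for i j s t
    using that by (auto simp: leg_def split: if_splits)
  have cont_leg: "continuous_on {0..1} (\<lambda>t. f (leg i t))" for i
  proof (rule continuous_on_compose2[OF cont])
    show "continuous_on {0..1} (leg i)"
      unfolding leg_def by (cases "i = 0"; cases "i = 1") (auto intro!: continuous_intros)
  qed (use leg_in in auto)
  \<comment> \<open>By connectedness the image of leg \<open>j\<close> contains the whole segment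
    from \<open>f (0, 0)\<close> to its end value. Injectivity then puts the end of leg
    \<open>i\<close> on leg \<open>j\<close>, but distinct legs share only the top.\<close>
  have meet: "i = j"
    if ij: "i < 3" "j < 3" and seg: "f (leg i 1) \<in> closed_segment (f (0, 0)) (f (leg j 1))" for i j
  proof -
    have "connected ((\<lambda>t. f (leg j t)) ` {0..1})"
      by (intro connected_continuous_image cont_leg) simp
    then have "convex ((\<lambda>t. f (leg j t)) ` {0..1})"
      by (metis is_interval_connected_1 is_interval_convex_1)
    then have "closed_segment (f (leg j 0)) (f (leg j 1)) \<subseteq> (\<lambda>t. f (leg j t)) ` {0..1}"
      by (intro closed_segment_subset) auto
    then obtain t where t: "t \<in> {0..1}" "f (leg i 1) = f (leg j t)"
      using seg by (auto simp: leg0)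
    then have "leg j t = leg i 1"
      using inj leg_in[of t j] leg_in[of 1 i] by (auto dest: inj_onD)
    then show ?thesis
      using leg_eq[of j t i 1] ij t by auto
  qed
  \<comment> \<open>Of two end values on the same side, the one nearer to \<open>f (0, 0)\<close>
    lies on the segment to the other, so \<open>meet\<close> applies in one of the two
    orders.\<close>
  have same_side: "i = j"
    if "i < 3" "j < 3" "(f (leg i 1) < f (0, 0)) = (f (leg j 1) < f (0, 0))" for i j
    using that meet[of i j] meet[of j i] linear[of "f (leg i 1)" "f (leg j 1)"]
    by (auto simp: closed_segment_eq_real_ivl split: if_splits)
  \<comment> \<open>Pigeonhole: three legs, two sides.\<close>
  show False
    using same_side[of 0 1] same_side[of 1 2] same_side[of 0 2] by auto
qed

lemma is_arc_no_triod:
  assumes "is_arc L" "continuous_on standard_triod f" "inj_on f standard_triod" "f ` standard_triod \<subseteq> L"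
  shows False
proof -
  obtain h k where hom: "homeomorphism L {0..1::real} h k"
    using assms(1) unfolding is_arc_def homeomorphic_def by blast
  then have "inj_on h L" "continuous_on L h"
    by (auto simp: homeomorphism_def intro: inj_on_inverseI)
  then have "continuous_on standard_triod (h \<circ> f)" "inj_on (h \<circ> f) standard_triod"
    using assms by (auto intro: continuous_on_compose comp_inj_on continuous_on_subset inj_on_subset simp del: o_apply)
  then show False
    by (rule standard_triod_not_embeddable_real)
qed

text \<open>Star-shapedness about the origin, which allows shrinking the triod within
  itself.\<close>

lemma scaleR_standard_triod:
  assumes "p \<in> standard_triod" "0 \<le> s" "s \<le> 1"
  shows "s *\<^sub>R p \<in> standard_triod"
proof -
  have "\<bar>s * a\<bar> \<le> 1" if "\<bar>a\<bar> \<le> 1" for a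
    using that assms by (simp add: abs_mult mult_le_one)
  then show ?thesis
    using assms by (auto simp: standard_triod_def abs_le_iff mult_le_one)
qed

lemma small_triod_avoiding_point:
  fixes T :: "'a::metric_space set"
  assumes "simple_triod_with_top T x" "x \<noteq> v"
  obtains f where "continuous_on standard_triod f" "inj_on f standard_triod"
    "f ` standard_triod \<subseteq> T - {v}"
proof -
  obtain h k where hom: "homeomorphism standard_triod T h k" and x: "h (0, 0) = x"
    using assms(1) unfolding simple_triod_with_top_def by blast
  have cont: "continuous_on standard_triod h" and im: "h ` standard_triod = T"
    and inj: "inj_on h standard_triod"
    using hom by (auto simp: homeomorphism_def intro: inj_on_inverseI)
  have "(0, 0) \<in> standard_triod" "dist x v > 0"
    using assms(2) by (auto simp: standard_triod_def)
  \<comment> \<open>Continuity at the top with tolerance \<open>dist x v\<close>: an image strictly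
    closer to \<open>x\<close> than \<open>v\<close> is cannot be \<open>v\<close>.\<close>
  then obtain d where d: "d > 0"
    "\<And>p. p \<in> standard_triod \<Longrightarrow> dist p (0, 0) < d \<Longrightarrow> dist (h p) x < dist x v"
    using cont x unfolding continuous_on_iff by metis
  \<comment> \<open>The bound 1 keeps the scaled triod inside the original. Points of the triod have
    norm at most 2, so the factor \<open>d / 4\<close> brings them strictly within \<open>d\<close>
    of the top.\<close>
  define s where "s = min 1 (d / 4)"
  have s: "0 < s" "s \<le> 1" "s * 2 < d"
    using d(1) by (auto simp: s_def min_def)
  have avoid: "h (s *\<^sub>R p) \<noteq> v" if p: "p \<in> standard_triod" for p
  proof -
    have "norm p \<le> \<bar>fst p\<bar> + \<bar>snd p\<bar>"
      by (metis norm_Pair_le prod.collapse real_norm_def)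
    also have "\<dots> \<le> 2"
      using p by (auto simp: standard_triod_def)
    finally have "s * norm p \<le> s * 2"
      using s by (intro mult_left_mono) auto
    also have "\<dots> < d"
      by (rule s(3))
    finally have "norm (s *\<^sub>R p) < d"
      using s(1) by simp
    then have "dist (h (s *\<^sub>R p)) x < dist x v"
      using d(2)[of "s *\<^sub>R p"] scaleR_standard_triod[OF p] s by (simp flip: zero_prod_def)
    then show ?thesis
      by (auto simp: dist_commute)
  qed
  have scaled: "(\<lambda>p. s *\<^sub>R p) ` standard_triod \<subseteq> standard_triod"
    using scaleR_standard_triod s by auto
  show thesis
  proof (rule that[of "\<lambda>p. h (s *\<^sub>R p)"])
    show "continuous_on standard_triod (\<lambda>p. h (s *\<^sub>R p))"
      using scaled by (intro continuous_on_compose2[OF cont]) (auto intro!: continuous_intros)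
    show "inj_on (\<lambda>p. h (s *\<^sub>R p)) standard_triod"
    proof (rule inj_onI)
      fix p q assume "p \<in> standard_triod" "q \<in> standard_triod" "h (s *\<^sub>R p) = h (s *\<^sub>R q)"
      then have "s *\<^sub>R p = s *\<^sub>R q"
        using scaled by (intro inj_onD[OF inj]) auto
      then show "p = q"
        using s(1) by (metis less_irrefl scaleR_left_imp_eq)
    qed
    show "(\<lambda>p. h (s *\<^sub>R p)) ` standard_triod \<subseteq> T - {v}"
      using scaled im avoid by auto
  qed
qed

section \<open>Arcwise connectedness and the final assembly\<close>

lemma arcwise_connected_Union_arcs:
  fixes v :: "'a::metric_space"
  assumes L: "\<And>L. L \<in> \<L> \<Longrightarrow> is_arc L \<and> v \<in> L"
    and Int: "\<And>L1 L2. L1 \<in> \<L> \<Longrightarrow> L2 \<in> \<L> \<Longrightarrow> L1 \<noteq> L2 \<Longrightarrow> L1 \<inter> L2 = {v}"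
  shows "arcwise_connected (\<Union>\<L>)"
  unfolding arcwise_connected_def
proof (intro ballI impI)
  fix x y assume "x \<in> \<Union>\<L>" "y \<in> \<Union>\<L>" "x \<noteq> y"
  then obtain M N where M: "M \<in> \<L>" "x \<in> M" and N: "N \<in> \<L>" "y \<in> N"
    by blast
  show "\<exists>g. arc g \<and> path_image g \<subseteq> \<Union>\<L> \<and> pathstart g = x \<and> pathfinish g = y"
  proof (cases "\<exists>K\<in>\<L>. x \<in> K \<and> y \<in> K")
    case True
    then obtain K where "K \<in> \<L>" "x \<in> K" "y \<in> K" by blast
    then show ?thesis
      using is_arc_subarc[of K x y] L \<open>x \<noteq> y\<close> by (metis Union_upper subset_trans)
  next
    \<comment> \<open>Since \<open>v\<close> lies in every member, neither point is \<open>v\<close>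
      here. Arcs to and from \<open>v\<close> in the two members meet only at \<open>v\<close>, so
      their concatenation stays injective.\<close>
    case False
    then have "x \<noteq> v" "y \<noteq> v" "M \<noteq> N"
      using L M N by auto
    obtain g where g: "arc g" "path_image g \<subseteq> M" "pathstart g = x" "pathfinish g = v"
      using is_arc_subarc[of M x v] L M \<open>x \<noteq> v\<close> by metis
    obtain h where h: "arc h" "path_image h \<subseteq> N" "pathstart h = v" "pathfinish h = y"
      using is_arc_subarc[of N v y] L N \<open>y \<noteq> v\<close> by metis
    have "path_image g \<inter> path_image h \<subseteq> {v}"
      using g h Int[OF M(1) N(1) \<open>M \<noteq> N\<close>] by blast
    then have "arc (g +++ h)"
      using g h by (intro arc_join) auto
    moreover have "path_image (g +++ h) \<subseteq> \<Union>\<L>"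
      using g h M N path_image_join_subset[of g h] by blast
    ultimately show ?thesis
      using g h by (metis pathstart_join pathfinish_join)
  qed
qed

theorem theorem3p3:
  fixes X :: "'a::metric_space set" and v :: 'a and \<L> :: "'a set set"
  assumes "continuum X"
    and "one_dimensional X"
    and "hereditarily_unicoherent X"
    and "v \<in> X"
    and "\<And>L. L \<in> \<L> \<Longrightarrow> is_arc L \<and> L \<subseteq> X"
    and "infinite \<L> \<or> card \<L> \<ge> 3"
    and "X = \<Union>\<L>"
    and "\<And>L1 L2. L1 \<in> \<L> \<Longrightarrow> L2 \<in> \<L> \<Longrightarrow> L1 \<noteq> L2 \<Longrightarrow> L1 \<inter> L2 = {v}"
  shows "fan X"
proof -
  have v_in: "v \<in> L" if "L \<in> \<L>" for L
  proof -
    \<comment> \<open>The pairwise condition puts \<open>v\<close> in \<open>L\<close> only once a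
      second member exists; a family inside \<open>{L}\<close> would be finite with at most one
      element.\<close>
    have "\<not> \<L> \<subseteq> {L}"
      using assms(6) finite_subset[of \<L> "{L}"] card_mono[of "{L}" \<L>] by auto
    then obtain M where "M \<in> \<L>" "M \<noteq> L" by blast
    then show ?thesis
      using assms(8)[OF that, of M] by blast
  qed
  have "arcwise_connected X"
    unfolding assms(7) using assms(5,8) v_in by (intro arcwise_connected_Union_arcs) auto
  then have "dendroid X"
    using assms by (simp add: dendroid_def)
  moreover have "x = v" if "ramification_point X x" for x
  proof (rule ccontr)
    assume "x \<noteq> v"
    with that obtain T f where T: "T \<subseteq> X"
      and f: "continuous_on standard_triod f" "inj_on f standard_triod"
        "f ` standard_triod \<subseteq> T - {v}"
      unfolding ramification_point_def by (metis small_triod_avoiding_point)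
    \<comment> \<open>The shrunken triod is a continuous image of a continuum and misses
      \<open>v\<close>, so a single arc of the family must contain it.\<close>
    have C: "subcontinuum (f ` standard_triod) X" "v \<notin> f ` standard_triod"
      using f T continuum_standard_triod
      by (auto simp: subcontinuum_def continuum_def compact_continuous_image connected_continuous_image)
    have "subcontinuum L X \<and> v \<in> L" if "L \<in> \<L>" for L
      using assms(5) v_in that is_arc_imp_continuum by (auto simp: subcontinuum_def)
    then obtain L where "L \<in> \<L>" "f ` standard_triod \<subseteq> L"
      by (rule subcontinuum_avoiding_centre[OF assms(3) _ assms(7) _ C]) (use assms(8) in auto)
    then show False
      using is_arc_no_triod f assms(5) by blast
  qed
  ultimately show ?thesis
    by (auto simp: fan_def Uniq_def)
qed

end
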